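(* Let $A$ be a Hermitian Banach $*$-algebra and let $a,b\in A$ be positive. Then the product $ab$ is positive if and only if $ab=ba$.
   Context: All algebras are complex. A Banach $*$-algebra is a complete complex algebra with an involution $a\mapsto a^*$ (conjugate linear, $(ab)^*=b^*a^*$, $a^{**}=a$) and a norm with $|ab|\le|a||b|$; the involution need not be continuous. $\widetilde A$ is $A$ if unital, otherwise $A$ with a unit $e$ adjoined, and $\mathrm{sp}(a)=\{\lambda:\lambda e-a\text{ not invertible in }\widetilde A\}$. $A$ is Hermitian if every Hermitian element ($a=a^*$) has real spectrum. An element $a$ is positive if $a=a^*$ and $\mathrm{sp}(a)\subset[0,\infty)$. *)

theory Defs
  imports "HOL-Analysis.Analysis"
begin

text \<open>A complex Banach algebra (not necessarily unital) is modelled on a type of class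
  real_normed_algebra (ring without unit, submultiplicative norm) and banach (complete),
  together with an explicit complex scalar multiplication cs extending the real one.\<close>

definition complex_banach_algebra ::
  "(complex \<Rightarrow> 'a::{real_normed_algebra,banach} \<Rightarrow> 'a) \<Rightarrow> bool" where
  "complex_banach_algebra cs \<longleftrightarrow>
     (\<forall>c x y. cs c (x + y) = cs c x + cs c y) \<and>
     (\<forall>c d x. cs (c + d) x = cs c x + cs d x) \<and>
     (\<forall>c d x. cs (c * d) x = cs c (cs d x)) \<and>
     (\<forall>r x. cs (complex_of_real r) x = r *\<^sub>R x) \<and>
     (\<forall>c x y. cs c (x * y) = cs c x * y \<and> cs c (x * y) = x * cs c y) \<and>
     (\<forall>c x. norm (cs c x) = norm c * norm x)"

definition involution ::
  "(complex \<Rightarrow> 'a::{real_normed_algebra,banach} \<Rightarrow> 'a) \<Rightarrow> ('a \<Rightarrow> 'a) \<Rightarrow> bool" where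
  "involution cs star \<longleftrightarrow>
     (\<forall>x y. star (x + y) = star x + star y) \<and>
     (\<forall>c x. star (cs c x) = cs (cnj c) (star x)) \<and>
     (\<forall>x y. star (x * y) = star y * star x) \<and>
     (\<forall>x. star (star x) = x)"

definition banach_star_algebra ::
  "(complex \<Rightarrow> 'a::{real_normed_algebra,banach} \<Rightarrow> 'a) \<Rightarrow> ('a \<Rightarrow> 'a) \<Rightarrow> bool" where
  "banach_star_algebra cs star \<longleftrightarrow> complex_banach_algebra cs \<and> involution cs star"

definition is_unit_elem :: "'a::ring \<Rightarrow> bool" where
  "is_unit_elem u \<longleftrightarrow> (\<forall>x. u * x = x \<and> x * u = x)"

definition unital_alg :: "'a::ring itself \<Rightarrow> bool" where
  "unital_alg _ \<longleftrightarrow> (\<exists>u::'a. is_unit_elem u)"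

text \<open>Multiplication in the unitization: pairs (mu, x) stand for mu e + x.\<close>
definition umult ::
  "(complex \<Rightarrow> 'a::ring \<Rightarrow> 'a) \<Rightarrow> complex \<times> 'a \<Rightarrow> complex \<times> 'a \<Rightarrow> complex \<times> 'a" where
  "umult cs p q = (fst p * fst q, cs (fst p) (snd q) + cs (fst q) (snd p) + snd p * snd q)"

definition spec ::
  "(complex \<Rightarrow> 'a::{real_normed_algebra,banach} \<Rightarrow> 'a) \<Rightarrow> 'a \<Rightarrow> complex set" where
  "spec cs a =
    (if unital_alg TYPE('a) then
       (let u = (SOME u::'a. is_unit_elem u) in
        {z. \<not> (\<exists>b. (cs z u - a) * b = u \<and> b * (cs z u - a) = u)})
     else
       {z. \<not> (\<exists>q. umult cs (z, - a) q = (1, 0) \<and> umult cs q (z, - a) = (1, 0))})"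

definition hermitian_alg ::
  "(complex \<Rightarrow> 'a::{real_normed_algebra,banach} \<Rightarrow> 'a) \<Rightarrow> ('a \<Rightarrow> 'a) \<Rightarrow> bool" where
  "hermitian_alg cs star \<longleftrightarrow> (\<forall>a. star a = a \<longrightarrow> spec cs a \<subseteq> \<real>)"

definition positive_elem ::
  "(complex \<Rightarrow> 'a::{real_normed_algebra,banach} \<Rightarrow> 'a) \<Rightarrow> ('a \<Rightarrow> 'a) \<Rightarrow> 'a \<Rightarrow> bool" where
  "positive_elem cs star a \<longleftrightarrow> star a = a \<and> spec cs a \<subseteq> complex_of_real ` {0..}"

end

theory Submission
  imports Defs
begin

text \<open>If \<open>a b\<close> is positive, it is Hermitian, so \<open>a b = (a b)\<^sup>* = b a\<close>. Conversely, if \<open>a\<close> and \<open>b\<close>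
  commute, then \<open>a b\<close> is Hermitian, so its spectrum is real, and after rescaling it remains to
  invert \<open>e + a b\<close>. Up to an invertible factor this is \<open>e - x y\<close> for commuting Moebius transforms
  \<open>x\<close> of \<open>a\<close> and \<open>y\<close> of \<open>b\<close> with spectral radius less than 1. Then \<open>(x y) ^ n = x ^ n y ^ n\<close> becomes
  small, so \<open>e - x y\<close> is invertible. Neither Gelfand theory nor square roots are needed, and the decay
  of powers is obtained by averaging resolvents instead of contour integration.\<close>

text \<open>The constant \<open>K\<close> allows for the Euclidean norm of the product type, which is not
  submultiplicative on the unitization.\<close>

locale unital_complex_banach =
  fixes mul :: "'b::banach \<Rightarrow> 'b \<Rightarrow> 'b" (infixl "\<odot>" 70)
    and sc :: "complex \<Rightarrow> 'b \<Rightarrow> 'b"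
    and e :: 'b
    and K :: real
  assumes mul_assoc: "(x \<odot> y) \<odot> z = x \<odot> (y \<odot> z)"
    and mul_add_left: "(x + y) \<odot> z = x \<odot> z + y \<odot> z"
    and mul_add_right: "x \<odot> (y + z) = x \<odot> y + x \<odot> z"
    and mul_e_left [simp]: "e \<odot> x = x"
    and mul_e_right [simp]: "x \<odot> e = x"
    and sc_add_left: "sc (c + d) x = sc c x + sc d x"
    and sc_add_right: "sc c (x + y) = sc c x + sc c y"
    and sc_sc [simp]: "sc c (sc d x) = sc (c * d) x"
    and sc_of_real: "sc (complex_of_real r) x = r *\<^sub>R x"
    and mul_sc_left [simp]: "sc c x \<odot> y = sc c (x \<odot> y)"
    and mul_sc_right [simp]: "x \<odot> sc c y = sc c (x \<odot> y)"
    and norm_sc: "norm (sc c x) = norm c * norm x"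
    and K_pos: "K > 0"
    and norm_mul: "norm (x \<odot> y) \<le> K * norm x * norm y"
begin

section \<open>Bilinearity of the product and the scalar action\<close>

lemma sc_1 [simp]: "sc 1 x = x"
  using sc_of_real[of 1 x] by simp

lemma sc_0_left [simp]: "sc 0 x = 0"
  using sc_of_real[of 0 x] by simp

lemma sc_0_right [simp]: "sc c 0 = 0"
  using sc_add_right[of c 0 0] by simp

lemma sc_minus_right: "sc c (- x) = - sc c x"
  using sc_add_right[of c x "- x"] by (simp add: eq_neg_iff_add_eq_0 add.commute)

lemma sc_minus_left: "sc (- c) x = - sc c x"
  using sc_add_left[of c "- c" x] by (simp add: eq_neg_iff_add_eq_0 add.commute)

lemma sc_diff_left: "sc (c - d) x = sc c x - sc d x"
  using sc_add_left[of c "- d" x] by (simp add: sc_minus_left)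

lemma sc_diff_right: "sc c (x - y) = sc c x - sc c y"
  using sc_add_right[of c x "- y"] by (simp add: sc_minus_right)

lemma mul_0_left [simp]: "0 \<odot> x = 0"
  using mul_add_left[of 0 0 x] by simp

lemma mul_0_right [simp]: "x \<odot> 0 = 0"
  using mul_add_right[of x 0 0] by simp

lemma mul_minus_left: "(- x) \<odot> y = - (x \<odot> y)"
  using mul_add_left[of x "- x" y] by (simp add: eq_neg_iff_add_eq_0 add.commute)

lemma mul_minus_right: "x \<odot> (- y) = - (x \<odot> y)"
  using mul_add_right[of x y "- y"] by (simp add: eq_neg_iff_add_eq_0 add.commute)

lemma mul_diff_left: "(x - y) \<odot> z = x \<odot> z - y \<odot> z"
  using mul_add_left[of x "- y" z] by (simp add: mul_minus_left)

lemma mul_diff_right: "x \<odot> (y - z) = x \<odot> y - x \<odot> z"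
  using mul_add_right[of x y "- z"] by (simp add: mul_minus_right)

lemmas alg = mul_add_left mul_add_right mul_diff_left mul_diff_right mul_minus_left mul_minus_right
  sc_add_left sc_add_right sc_diff_left sc_diff_right sc_minus_left sc_minus_right mul_assoc

section \<open>Invertible elements and perturbation of the unit\<close>

definition inverse_pair :: "'b \<Rightarrow> 'b \<Rightarrow> bool" where
  "inverse_pair x y \<longleftrightarrow> x \<odot> y = e \<and> y \<odot> x = e"

definition invertible :: "'b \<Rightarrow> bool" where
  "invertible x \<longleftrightarrow> (\<exists>y. inverse_pair x y)"

lemma invertibleI: "x \<odot> y = e \<Longrightarrow> z \<odot> x = e \<Longrightarrow> invertible x"
  unfolding invertible_def inverse_pair_def by (metis mul_assoc mul_e_left mul_e_right)

lemma invertible_sc: "invertible x \<Longrightarrow> c \<noteq> 0 \<Longrightarrow> invertible (sc c x)"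
  unfolding invertible_def inverse_pair_def
  by (elim exE, rule_tac x = "sc (1 / c) y" in exI) simp

lemma invertible_mul:
  assumes "invertible x" "invertible y"
  shows "invertible (x \<odot> y)"
proof -
  obtain x' y' where "inverse_pair x x'" "inverse_pair y y'"
    using assms invertible_def by blast
  then have "inverse_pair (x \<odot> y) (y' \<odot> x')"
    unfolding inverse_pair_def by (metis mul_assoc mul_e_left)
  then show ?thesis using invertible_def by blast
qed

text \<open>If \<open>z\<close> inverts \<open>x y\<close>, then \<open>y z\<close> is a right
  inverse of \<open>x\<close>; commutation makes \<open>z y\<close> a left inverse.\<close>

lemma invertible_factor:
  assumes "x \<odot> y = y \<odot> x" "invertible (x \<odot> y)"
  shows "invertible x"
proof -
  obtain z where z: "(x \<odot> y) \<odot> z = e" "z \<odot> (x \<odot> y) = e"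
    using assms(2) unfolding invertible_def inverse_pair_def by blast
  have "x \<odot> (y \<odot> z) = e" using z(1) by (simp only: mul_assoc)
  moreover have "(z \<odot> y) \<odot> x = e" using z(2) by (simp only: mul_assoc assms(1))
  ultimately show ?thesis by (rule invertibleI)
qed

lemma inverse_commute:
  assumes "inverse_pair x x'" "x \<odot> y = y \<odot> x"
  shows "x' \<odot> y = y \<odot> x'"
proof -
  have "x' \<odot> y = x' \<odot> (y \<odot> x) \<odot> x'"
    using assms(1) by (simp add: inverse_pair_def mul_assoc)
  also have "\<dots> = (x' \<odot> x) \<odot> y \<odot> x'"
    by (simp only: assms(2)[symmetric] mul_assoc)
  also have "\<dots> = y \<odot> x'"
    using assms(1) by (simp add: inverse_pair_def)
  finally show ?thesis .
qed

text \<open>The maps sending \<open>y\<close> to \<open>e + x y\<close> and to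
  \<open>e + y x\<close> are contractions; their fixed points are a right and a left inverse of
  \<open>e - x\<close>.\<close>

lemma invertible_one_minus:
  assumes "K * norm x < 1"
  shows "invertible (e - x)"
proof -
  have c: "0 \<le> K * norm x" using K_pos by simp
  have "\<exists>!y. e + x \<odot> y = y"
  proof (intro banach_fix_type[OF c assms] allI)
    show "dist (e + x \<odot> y) (e + x \<odot> z) \<le> K * norm x * dist y z" for y z
      using norm_mul[of x] by (simp add: dist_norm flip: mul_diff_right)
  qed
  then obtain y where y: "e + x \<odot> y = y" by blast
  have "\<exists>!y. e + y \<odot> x = y"
  proof (intro banach_fix_type[OF c assms] allI)
    show "dist (e + y \<odot> x) (e + z \<odot> x) \<le> K * norm x * dist y z" for y z
      using norm_mul[of "y - z" x] by (simp add: dist_norm mult_ac flip: mul_diff_left)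
  qed
  then obtain z where z: "e + z \<odot> x = z" by blast
  show ?thesis
    by (rule invertibleI[of _ y z]) (use y z in \<open>simp_all add: alg algebra_simps\<close>)
qed

section \<open>Iterated squaring\<close>

text \<open>The power \<open>x^(2^k)\<close>. Such exponents can be handled through
  \<open>e - v^2 = (e - v)(e + v)\<close> alone.\<close>

fun pow2 :: "nat \<Rightarrow> 'b \<Rightarrow> 'b" where
  "pow2 0 x = x"
| "pow2 (Suc k) x = pow2 k x \<odot> pow2 k x"

lemma pow2_sc: "pow2 k (sc z x) = sc (z ^ (2 ^ k)) (pow2 k x)"
  by (induction k) (simp_all add: power_mult_distrib mult_2 power_add)

lemma pow2_0 [simp]: "pow2 k 0 = 0"
  by (induction k) simp_all

lemma pow2_commute:
  assumes "x \<odot> y = y \<odot> x"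
  shows "pow2 k x \<odot> pow2 j y = pow2 j y \<odot> pow2 k x"
proof -
  have *: "pow2 k x \<odot> y = y \<odot> pow2 k x" if "x \<odot> y = y \<odot> x" for x y k
  proof (induction k)
    case (Suc k)
    then show ?case by (metis mul_assoc pow2.simps(2))
  qed (simp add: that)
  show ?thesis using * assms by metis
qed

lemma pow2_mul:
  assumes "x \<odot> y = y \<odot> x"
  shows "pow2 k (x \<odot> y) = pow2 k x \<odot> pow2 k y"
proof (induction k)
  case (Suc k)
  have "(p \<odot> q) \<odot> (p \<odot> q) = (p \<odot> p) \<odot> (q \<odot> q)" if "p \<odot> q = q \<odot> p" for p q
    using that by (metis mul_assoc)
  then show ?case using Suc pow2_commute[OF assms, of k k] by simp
qed simp

text \<open>In \<open>e - v^2 = (e - v)(e + v)\<close> the factors commute, so invertibility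
  descends one squaring at a time.\<close>

lemma invertible_one_minus_pow2:
  "invertible (e - pow2 k x) \<Longrightarrow> invertible (e - x)"
proof (induction k)
  case (Suc k)
  have "invertible (e - pow2 k x)"
    by (rule invertible_factor[where y = "e + pow2 k x"])
      (use Suc.prems in \<open>simp_all add: alg algebra_simps\<close>)
  then show ?case by (rule Suc.IH)
qed simp

section \<open>Resolvents and their continuity\<close>

text \<open>Partial fractions: \<open>1/(1 - v^2)\<close> is the mean of \<open>1/(1 - v)\<close>
  and \<open>1/(1 + v)\<close>.\<close>

lemma inverse_pair_average:
  assumes "inverse_pair (e - v) g" "inverse_pair (e + v) h"
  shows "inverse_pair (e - v \<odot> v) (sc (1/2) (g + h))"
proof -
  have fac: "e - v \<odot> v = (e + v) \<odot> (e - v)" "e - v \<odot> v = (e - v) \<odot> (e + v)"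
    by (simp_all add: alg algebra_simps)
  have two: "sc (1/2) (e + e) = e"
    using sc_add_left[of "1/2" "1/2" e] by (simp add: sc_add_right)
  have "(e - v \<odot> v) \<odot> g = e + v" "(e - v \<odot> v) \<odot> h = e - v"
    using assms unfolding inverse_pair_def by (metis fac mul_assoc mul_e_right)+
  moreover have "g \<odot> (e - v \<odot> v) = e + v" "h \<odot> (e - v \<odot> v) = e - v"
    using assms unfolding inverse_pair_def by (metis fac mul_assoc mul_e_left)+
  ultimately show ?thesis
    unfolding inverse_pair_def using two by (simp add: mul_add_left mul_add_right)
qed

text \<open>Insert \<open>e - w x\<close> and \<open>e - z x\<close> between \<open>f\<close> and
  \<open>g\<close>: each cancels one factor, and their difference is
  \<open>(z - w) x\<close>.\<close>

lemma resolvent_identity: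
  assumes "inverse_pair (e - sc z x) f" "inverse_pair (e - sc w x) g"
  shows "f - g = sc (z - w) (f \<odot> (x \<odot> g))"
proof -
  have "f \<odot> ((e - sc w x) \<odot> g) - (f \<odot> (e - sc z x)) \<odot> g = sc (z - w) (f \<odot> (x \<odot> g))"
    by (simp add: alg algebra_simps)
  then show ?thesis using assms by (simp add: inverse_pair_def)
qed

text \<open>The resolvent identity bounds \<open>F w - F z\<close> by
  \<open>|w - z| C |F w|\<close>. Near \<open>z\<close> this forces \<open>|F w|\<close> to be at
  most \<open>2 |F z|\<close>, which leaves a bound linear in \<open>|w - z|\<close>.\<close>

lemma continuous_on_resolvent:
  assumes F: "\<And>z. z \<in> S \<Longrightarrow> inverse_pair (e - sc z x) (F z)"
  shows "continuous_on S F"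
proof -
  have "(F \<longlongrightarrow> F z) (at z within S)" if z: "z \<in> S" for z
  proof -
    define C where "C = K * norm (F z) * K * norm x"
    have C: "C \<ge> 0" using K_pos by (simp add: C_def)
    have diff: "norm (F w - F z) \<le> cmod (w - z) * C * norm (F w)" if "w \<in> S" for w
    proof -
      have "norm (F z \<odot> (x \<odot> F w)) \<le> K * norm (F z) * (K * norm x * norm (F w))"
        using K_pos by (intro order.trans[OF norm_mul] mult_left_mono norm_mul) auto
      then have "cmod (z - w) * norm (F z \<odot> (x \<odot> F w))
          \<le> cmod (z - w) * (K * norm (F z) * (K * norm x * norm (F w)))"
        by (rule mult_left_mono) simp
      moreover have "norm (F w - F z) = cmod (z - w) * norm (F z \<odot> (x \<odot> F w))"
        using resolvent_identity[OF F[OF z] F[OF that]] by (metis norm_minus_commute norm_sc)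
      ultimately show ?thesis
        by (simp add: C_def mult_ac norm_minus_commute)
    qed
    have bd: "norm (F w - F z) \<le> 2 * C * norm (F z) * cmod (w - z)"
      if w: "w \<in> S" "cmod (w - z) * C \<le> 1/2" for w
    proof -
      have "norm (F w) \<le> norm (F z) + norm (F w - F z)"
        using norm_triangle_ineq[of "F z" "F w - F z"] by simp
      also have "norm (F w - F z) \<le> 1/2 * norm (F w)"
        using diff[OF w(1)] mult_right_mono[OF w(2) norm_ge_zero[of "F w"]] by linarith
      finally have "norm (F w) \<le> 2 * norm (F z)" by simp
      then have "cmod (w - z) * C * norm (F w) \<le> cmod (w - z) * C * (2 * norm (F z))"
        using C by (intro mult_left_mono) auto
      then show ?thesis using diff[OF w(1)] by (simp add: mult_ac)
    qed
    have lim: "((\<lambda>w. cmod (w - z)) \<longlongrightarrow> 0) (at z within S)"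
      by (intro tendsto_eq_intros) auto
    have "\<forall>\<^sub>F w in at z within S. cmod (w - z) * C < 1/2"
      by (rule order_tendstoD(2)[where y = 0]) (use tendsto_mult_right[OF lim, of C] in auto)
    moreover have "\<forall>\<^sub>F w in at z within S. w \<in> S"
      by (simp add: eventually_at_filter)
    ultimately have "\<forall>\<^sub>F w in at z within S.
        norm (F w - F z) \<le> 2 * C * norm (F z) * cmod (w - z)"
      by eventually_elim (use bd in auto)
    then have "((\<lambda>w. F w - F z) \<longlongrightarrow> 0) (at z within S)"
      by (rule Lim_null_comparison) (use tendsto_mult_left[OF lim] in auto)
    then show ?thesis by (simp add: LIM_zero_iff)
  qed
  then show ?thesis by (simp add: continuous_on_def)
qed

text \<open>The resolvents of the powers \<open>x ^ 2 ^ k\<close> are averages of rotated resolvents of \<open>x\<close>,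
  hence they all share the modulus of continuity of the latter.\<close>

lemma equicontinuous_resolvents:
  assumes inv: "\<And>z. cmod z \<le> 1 \<Longrightarrow> invertible (e - sc z x)" and "\<epsilon> > 0"
  obtains \<delta> where "\<delta> > 0"
    and "\<And>k z w. \<lbrakk>cmod z \<le> 1; cmod w \<le> 1; dist z w < \<delta>\<rbrakk> \<Longrightarrow>
      \<exists>g h. inverse_pair (e - pow2 k (sc z x)) g \<and> inverse_pair (e - pow2 k (sc w x)) h \<and>
        norm (g - h) \<le> \<epsilon>"
proof -
  obtain F where F: "\<And>z. cmod z \<le> 1 \<Longrightarrow> inverse_pair (e - sc z x) (F z)"
    using inv unfolding invertible_def by metis
  have "continuous_on (cball 0 1) F"
    by (rule continuous_on_resolvent) (use F in auto)
  then have "uniformly_continuous_on (cball 0 1) F"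
    by (rule compact_uniformly_continuous) simp
  then obtain \<delta> where \<delta>: "\<delta> > 0" "\<And>z w. \<lbrakk>cmod z \<le> 1; cmod w \<le> 1; dist z w < \<delta>\<rbrakk>
      \<Longrightarrow> norm (F z - F w) < \<epsilon>"
    unfolding uniformly_continuous_on_def using \<open>\<epsilon> > 0\<close>
    by (metis dist_norm mem_cball_0 norm_minus_commute)
  have "\<exists>g h. inverse_pair (e - pow2 k (sc z x)) g \<and> inverse_pair (e - pow2 k (sc w x)) h \<and>
        norm (g - h) \<le> \<epsilon>"
    if "cmod z \<le> 1" "cmod w \<le> 1" "dist z w < \<delta>" for k z w
    using that
  proof (induction k arbitrary: z w)
    case 0
    then show ?case using F \<delta>(2) by (metis pow2.simps(1) order.strict_implies_order)
  next
    case (Suc k)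
    \<comment> \<open>As \<open>\<omega>^(2^k) = -1\<close>, multiplying \<open>z\<close> by
      \<open>\<omega>\<close> negates \<open>pow2 k (sc z x)\<close> and preserves moduli and
      distances. So one \<open>\<delta>\<close> serves both halves of the average, for every
      \<open>k\<close>.\<close>
    define \<omega> where "\<omega> = cis (pi / 2 ^ k)"
    have \<omega>: "cmod \<omega> = 1" "\<omega> ^ 2 ^ k = -1"
      by (simp_all add: \<omega>_def Complex.DeMoivre)
    have neg: "e - pow2 k (sc (\<omega> * z) x) = e + pow2 k (sc z x)" for z
      using \<omega>(2) by (simp add: pow2_sc power_mult_distrib sc_minus_left)
    have "dist (\<omega> * z) (\<omega> * w) < \<delta>"
      using Suc.prems \<omega>(1) by (simp add: dist_norm norm_mult flip: right_diff_distrib)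
    then obtain g h g' h' where
      g: "inverse_pair (e - pow2 k (sc z x)) g" "inverse_pair (e - pow2 k (sc w x)) h"
        "norm (g - h) \<le> \<epsilon>" and
      g': "inverse_pair (e + pow2 k (sc z x)) g'" "inverse_pair (e + pow2 k (sc w x)) h'"
        "norm (g' - h') \<le> \<epsilon>"
      using Suc.IH[OF Suc.prems] Suc.IH[of "\<omega> * z" "\<omega> * w"] Suc.prems \<omega>(1)
      by (auto simp: norm_mult neg)
    have "norm (sc (1/2) (g + g') - sc (1/2) (h + h')) = 1/2 * norm ((g - h) + (g' - h'))"
      by (simp add: norm_sc algebra_simps flip: sc_diff_right)
    also have "\<dots> \<le> \<epsilon>"
      using norm_triangle_ineq[of "g - h" "g' - h'"] g(3) g'(3) by simp
    finally show ?case
      using inverse_pair_average[OF g(1) g'(1)] inverse_pair_average[OF g(2) g'(2)] by auto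
  qed
  with \<delta>(1) show ?thesis using that by blast
qed

section \<open>Decay of the powers\<close>

text \<open>\<open>K * norm\<close> is submultiplicative, so each squaring squares the
  bound.\<close>

lemma pow2_small_mono:
  assumes "K * norm (pow2 k x) \<le> c" "0 \<le> c"
  shows "K * norm (pow2 (k + j) x) \<le> c ^ 2 ^ j"
proof (induction j)
  case (Suc j)
  have "K * norm (pow2 (k + Suc j) x) \<le> K * (K * norm (pow2 (k + j) x) * norm (pow2 (k + j) x))"
    using K_pos norm_mul by (intro mult_left_mono) auto
  also have "\<dots> = (K * norm (pow2 (k + j) x)) ^ 2"
    by (simp add: power2_eq_square)
  also have "\<dots> \<le> (c ^ 2 ^ j) ^ 2"
    using Suc K_pos by (intro power_mono) auto
  finally show ?case by (simp add: power_mult mult.commute[of 2] flip: power_mult)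
qed (use assms in simp)

text \<open>The half of the spectral radius formula that is needed: if the spectrum lies in the open unit
  disc, then the powers decay. Smallness of \<open>(r x) ^ 2 ^ k\<close> is propagated from \<open>r = 0\<close> to \<open>r = 1\<close>
  in finitely many steps of uniform length.\<close>

lemma pow2_eventually_small:
  assumes inv: "\<And>z. cmod z \<le> 1 \<Longrightarrow> invertible (e - sc z x)"
  shows "\<exists>k. K * norm (pow2 k x) \<le> 1/4"
proof -
  \<comment> \<open>The two errors below then add up to \<open>1/3 + 1/12 = 5/12\<close>, small
    enough for \<open>K * norm W \<le> 5/7 < 1\<close>.\<close>
  define \<epsilon> where "\<epsilon> = 1 / (12 * K)"
  have "\<epsilon> > 0" using K_pos by (simp add: \<epsilon>_def)
  then obtain \<delta> where \<delta>: "\<delta> > 0"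
    "\<And>k z w. \<lbrakk>cmod z \<le> 1; cmod w \<le> 1; dist z w < \<delta>\<rbrakk> \<Longrightarrow>
      \<exists>g h. inverse_pair (e - pow2 k (sc z x)) g \<and> inverse_pair (e - pow2 k (sc w x)) h \<and>
        norm (g - h) \<le> \<epsilon>"
    using equicontinuous_resolvents[OF inv] by metis
  have step: "\<exists>k. K * norm (pow2 k (sc w x)) \<le> 1/4"
    if zw: "cmod z \<le> 1" "cmod w \<le> 1" "dist z w < \<delta>" and k: "K * norm (pow2 k (sc z x)) \<le> 1/4"
    for z w k
  proof -
    define V W where "V = pow2 k (sc z x)" and "W = pow2 k (sc w x)"
    obtain g h where gh: "inverse_pair (e - V) g" "inverse_pair (e - W) h" "norm (g - h) \<le> \<epsilon>"
      using \<delta>(2)[OF zw] unfolding V_def W_def by blast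
    have "K * norm (g - e) \<le> 1/3"
    proof -
      \<comment> \<open>\<open>(e - V) g = e\<close> says that \<open>g - e = V g\<close>.\<close>
      have "g - e = V + V \<odot> (g - e)"
        using gh(1) by (simp add: inverse_pair_def alg algebra_simps)
      then have "norm (g - e) \<le> norm V + K * norm V * norm (g - e)"
        using norm_triangle_ineq[of V "V \<odot> (g - e)"] norm_mul[of V "g - e"] by simp
      also have "\<dots> \<le> norm V + 1/4 * norm (g - e)"
        using k mult_right_mono[of "K * norm V" "1/4" "norm (g - e)"] by (simp add: V_def)
      finally have "norm (g - e) \<le> 4/3 * norm V" by simp
      then have "K * norm (g - e) \<le> K * (4/3 * norm V)"
        using K_pos by (intro mult_left_mono) auto
      then show ?thesis using k by (simp add: V_def)
    qed
    moreover have "K * norm (g - h) \<le> 1/12"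
      using mult_left_mono[OF gh(3), of K] K_pos by (simp add: \<epsilon>_def)
    moreover have "K * norm (h - e) \<le> K * (norm (g - e) + norm (g - h))"
      using K_pos norm_triangle_ineq4[of "g - e" "g - h"] by (intro mult_left_mono) auto
    ultimately have h: "K * norm (h - e) \<le> 5/12"
      by (simp add: distrib_left)
    \<comment> \<open>From \<open>h (e - W) = e\<close>; it carries the smallness of
      \<open>h - e\<close> over to \<open>W\<close>.\<close>
    have "W = (h - e) - (h - e) \<odot> W"
      using gh(2) by (simp add: inverse_pair_def alg algebra_simps)
    then have "norm W \<le> norm (h - e) + K * norm (h - e) * norm W"
      using norm_triangle_ineq4[of "h - e" "(h - e) \<odot> W"] norm_mul[of "h - e" W] by simp
    also have "\<dots> \<le> norm (h - e) + 5/12 * norm W"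
      using mult_right_mono[OF h norm_ge_zero[of W]] by simp
    finally have "norm W \<le> 12/7 * norm (h - e)" by simp
    then have "K * norm W \<le> K * (12/7 * norm (h - e))"
      using K_pos by (intro mult_left_mono) auto
    then have "K * norm W \<le> 5/7" using h by simp
    \<comment> \<open>Three squarings bring the bound \<open>5/7\<close> back below
      \<open>1/4\<close>; two would not.\<close>
    then have "K * norm (pow2 (k + 3) (sc w x)) \<le> (5/7) ^ 2 ^ 3"
      unfolding W_def by (rule pow2_small_mono) simp
    also have "\<dots> \<le> 1/4" by (simp add: power_divide)
    finally show ?thesis by blast
  qed
  obtain n :: nat where n: "n > 0" "1 / real n < \<delta>"
    using \<delta>(1) by (metis inverse_eq_divide reals_Archimedean zero_less_Suc)
  have "\<exists>k. K * norm (pow2 k (sc (of_real (real i / real n)) x)) \<le> 1/4" if "i \<le> n" for i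
    using that
  proof (induction i)
    case (Suc i)
    then obtain k where k: "K * norm (pow2 k (sc (of_real (real i / real n)) x)) \<le> 1/4"
      by auto
    have d: "cmod (of_real (real i / real n) - of_real (real (Suc i) / real n)) = 1 / real n"
      unfolding of_real_diff[symmetric] norm_of_real by (simp add: add_divide_distrib)
    show ?case
      by (rule step[OF _ _ _ k]) (use Suc.prems n d in \<open>auto simp: dist_norm norm_divide simp del: of_real_divide\<close>)
  qed simp
  from this[of n] show ?thesis using n by simp
qed

section \<open>Products of commuting elements\<close>

text \<open>Each factor has a small power of its own. The common exponent \<open>2^(j + k)\<close>
  keeps both below \<open>1/4\<close>, and by commutation the same power of \<open>x y\<close> is
  small.\<close>

lemma invertible_one_minus_mul:
  assumes "\<And>z. cmod z \<le> 1 \<Longrightarrow> invertible (e - sc z x)"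
    and "\<And>z. cmod z \<le> 1 \<Longrightarrow> invertible (e - sc z y)"
    and comm: "x \<odot> y = y \<odot> x"
  shows "invertible (e - x \<odot> y)"
proof -
  obtain j k where j: "K * norm (pow2 j x) \<le> 1/4" and k: "K * norm (pow2 k y) \<le> 1/4"
    using pow2_eventually_small[OF assms(1)] pow2_eventually_small[OF assms(2)] by blast
  have le: "(1/4::real) ^ 2 ^ m \<le> 1/4" for m
    using power_decreasing[of 1 "2 ^ m" "1/4::real"] by simp
  have j': "K * norm (pow2 (j + k) x) \<le> 1/4"
    using pow2_small_mono[OF j, of k] le[of k] by simp
  have k': "K * norm (pow2 (j + k) y) \<le> 1/4"
    using pow2_small_mono[OF k, of j] le[of j] by (simp add: add.commute)
  have "K * norm (pow2 (j + k) (x \<odot> y)) \<le> K * (K * norm (pow2 (j + k) x) * norm (pow2 (j + k) y))"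
    unfolding pow2_mul[OF comm] by (rule mult_left_mono[OF norm_mul]) (use K_pos in simp)
  also have "\<dots> = (K * norm (pow2 (j + k) x)) * (K * norm (pow2 (j + k) y))"
    by simp
  also have "\<dots> \<le> 1/4 * (1/4)"
    using j' k' K_pos by (intro mult_mono) auto
  finally have "K * norm (pow2 (j + k) (x \<odot> y)) < 1" by simp
  then show ?thesis by (rule invertible_one_minus_pow2[OF invertible_one_minus])
qed

text \<open>\<open>nonneg_spectrum x\<close> says that the spectrum of \<open>x\<close> is contained in \<open>[0, \<infinity>)\<close>, with \<open>w\<close> being the
  reciprocal of the spectral parameter.\<close>

definition nonneg_spectrum :: "'b \<Rightarrow> bool" where
  "nonneg_spectrum x \<longleftrightarrow> (\<forall>w. w \<notin> complex_of_real ` {0<..} \<longrightarrow> invertible (e - sc w x))"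

text \<open>\<open>nonneg_spectrum\<close> is silent on positive \<open>w\<close>; the small ones
  are covered by perturbation of the unit.\<close>

lemma invertible_of_nonneg_spectrum:
  assumes "nonneg_spectrum x" and "\<And>s. s > 0 \<Longrightarrow> w = complex_of_real s \<Longrightarrow> s * (K * norm x) < 1"
  shows "invertible (e - sc w x)"
proof (cases "w \<in> complex_of_real ` {0<..}")
  case True
  then obtain s where "s > 0" "w = complex_of_real s" by auto
  then show ?thesis
    using assms(2) by (intro invertible_one_minus) (simp add: norm_sc mult_ac)
next
  case False
  then show ?thesis using assms(1) by (simp add: nonneg_spectrum_def)
qed

text \<open>Write \<open>e + a b = (e - x y) (e + c b)\<close> with \<open>x = (a - c) / c'\<close> and
  \<open>y = - c' b (e + c b)\<^sup>-\<^sup>1\<close>. If \<open>2 c\<close> exceeds the spectral radius of \<open>a\<close> and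
  \<open>c'\<close> is slightly larger than \<open>c\<close>, then \<open>x\<close> and \<open>y\<close> have spectral radius less than 1.\<close>

lemma invertible_one_plus_mul:
  assumes a: "nonneg_spectrum a" and b: "nonneg_spectrum b" and comm: "a \<odot> b = b \<odot> a"
  shows "invertible (e + a \<odot> b)"
proof -
  \<comment> \<open>In terms of spectra: \<open>a\<close> lies in \<open>[0, 2c)\<close>, so
    \<open>a - c\<close> has modulus at most \<open>c < c'\<close>; and
    \<open>c' t / (1 + c t) < 1\<close> for \<open>0 \<le> t \<le> K * norm b\<close>, because
    \<open>(c' - c) t < 1\<close>.\<close>
  define c where "c = (K * norm a + 1) / 2"
  define c' where "c' = c + 1 / (K * norm b + 1)"
  have nn: "K * norm a \<ge> 0" "K * norm b \<ge> 0" using K_pos by auto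
  have c: "c > 0" "K * norm a < 2 * c" using nn by (auto simp: c_def)
  have c': "c' > c" using nn by (simp add: c'_def)
  have c'b: "(c' - c) * (K * norm b) < 1" using nn by (simp add: c'_def field_simps)
  have "invertible (e - sc (- of_real c) b)"
  proof (rule invertible_of_nonneg_spectrum[OF b])
    fix s assume "s > 0" "- complex_of_real c = complex_of_real s"
    then have "- c = s" by (metis of_real_eq_iff of_real_minus)
    then show "s * (K * norm b) < 1" using \<open>s > 0\<close> c(1) by simp
  qed
  then have cb: "invertible (e + sc (of_real c) b)"
    by (simp add: sc_minus_left)
  then obtain d where d: "inverse_pair (e + sc (of_real c) b) d"
    using invertible_def by blast
  define x where "x = sc (of_real (1 / c')) (a - sc (of_real c) e)"
  define y where "y = sc (of_real (- c')) (b \<odot> d)"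
  have bd: "b \<odot> d = d \<odot> b"
    using inverse_commute[OF d, of b] by (simp add: alg)
  have ad: "a \<odot> d = d \<odot> a"
    using inverse_commute[OF d, of a] by (simp add: alg comm)
  have "invertible (e - sc z x)" if z: "cmod z \<le> 1" for z
  proof -
    have "cmod z * c < c'"
      using mult_right_mono[OF z, of c] c(1) c' by linarith
    then have "cmod (z * of_real c) < c'"
      using c(1) by (simp add: norm_mult)
    moreover have "cmod (z * of_real c) = c'" if "of_real c' + z * of_real c = 0"
    proof -
      from that have "z * of_real c = - of_real c'" by (simp add: eq_neg_iff_add_eq_0 add.commute)
      then show ?thesis using c c' by simp
    qed
    ultimately have ne: "of_real c' + z * of_real c \<noteq> 0" by auto
    \<comment> \<open>With this \<open>w\<close>, \<open>e - z x\<close> is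
      \<open>1 + z c / c'\<close> times \<open>e - w a\<close>.\<close>
    define w where "w = z / (of_real c' + z * of_real c)"
    have "invertible (e - sc w a)"
    proof (rule invertible_of_nonneg_spectrum[OF a])
      fix s assume s: "s > 0" "w = complex_of_real s"
      then have "z = of_real s * (of_real c' + z * of_real c)"
        using ne by (simp add: w_def field_simps)
      then have "z * of_real (1 - s * c) = of_real (s * c')"
        by (simp add: algebra_simps)
      then have "cmod z * \<bar>1 - s * c\<bar> = s * c'"
        using s c c' by (metis norm_mult norm_of_real abs_of_pos less_trans mult_pos_pos)
      moreover have "cmod z * \<bar>1 - s * c\<bar> \<le> 1 * \<bar>1 - s * c\<bar>"
        using z by (intro mult_right_mono) auto
      moreover have "s * c < s * c'" using s c' by simp
      moreover have "s * c > 0" using s c by simp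
      \<comment> \<open>\<open>s c' \<le> |1 - s c|\<close> rules out \<open>s c \<ge> 1\<close>, as
        \<open>c' > c\<close>; hence \<open>s c' \<le> 1 - s c\<close>.\<close>
      ultimately have "s * (2 * c) < 1" by (simp add: abs_if split: if_splits)
      moreover have "s * (K * norm a) \<le> s * (2 * c)"
        using s c by (intro mult_left_mono) auto
      ultimately show "s * (K * norm a) < 1" by simp
    qed
    then have "invertible (sc (1 + z * of_real c / of_real c') (e - sc w a))"
      by (rule invertible_sc) (use ne c c' in \<open>auto simp: field_simps\<close>)
    moreover have "(1 + z * of_real c / of_real c') * w = z / of_real c'"
    proof -
      have "1 + z * of_real c / of_real c' = (of_real c' + z * of_real c) / of_real c'"
        using c c' by (simp add: add_divide_distrib)
      then show ?thesis using ne by (simp add: w_def)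
    qed
    ultimately show ?thesis
      by (simp add: x_def alg add_diff_eq diff_diff_eq2)
  qed
  moreover have "invertible (e - sc z y)" if z: "cmod z \<le> 1" for z
  proof -
    \<comment> \<open>\<open>(e + c b) d = e\<close> turns \<open>e - z y\<close> into
      \<open>(e - w b) d\<close>.\<close>
    define w where "w = - (of_real c + z * of_real c')"
    have "invertible (e - sc w b)"
    proof (rule invertible_of_nonneg_spectrum[OF b])
      fix s assume s: "s > 0" "w = complex_of_real s"
      then have "z * of_real c' = - of_real (c + s)"
        by (simp add: w_def) (metis add.commute add_diff_cancel_left' minus_add_distrib minus_minus uminus_add_conv_diff)
      then have "cmod z * c' = c + s"
        using s c c' by (metis norm_mult norm_of_real norm_minus_cancel abs_of_pos less_trans add_pos_pos)
      then have "s \<le> c' - c"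
        using mult_right_mono[OF z, of c'] c c' by simp
      then have "s * (K * norm b) \<le> (c' - c) * (K * norm b)"
        by (rule mult_right_mono) (use nn in auto)
      then show "s * (K * norm b) < 1" using c'b by simp
    qed
    moreover have "invertible d" using d unfolding invertible_def inverse_pair_def by blast
    ultimately have "invertible ((e - sc w b) \<odot> d)" by (rule invertible_mul)
    moreover have "e - sc z y = (e - sc w b) \<odot> d"
    proof -
      have "(e - sc w b) \<odot> d = (e + sc (of_real c) b) \<odot> d + sc (z * of_real c') (b \<odot> d)"
        by (simp add: w_def alg)
      also have "\<dots> = e - sc z y"
        using d by (simp add: inverse_pair_def y_def sc_minus_left sc_minus_right)
      finally show ?thesis by simp
    qed
    ultimately show ?thesis by simp
  qed
  moreover have "x \<odot> y = y \<odot> x"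
  proof -
    have "a \<odot> (b \<odot> d) = (b \<odot> d) \<odot> a"
      by (metis ad comm mul_assoc)
    then show ?thesis by (simp add: x_def y_def alg mult_ac)
  qed
  ultimately have "invertible (e - x \<odot> y)"
    by (rule invertible_one_minus_mul)
  then have "invertible ((e - x \<odot> y) \<odot> (e + sc (of_real c) b))"
    using cb by (rule invertible_mul)
  \<comment> \<open>Here \<open>d\<close> cancels against \<open>e + c b\<close>, leaving
    \<open>e + c b + (a - c) b\<close>.\<close>
  moreover have "(e - x \<odot> y) \<odot> (e + sc (of_real c) b) = e + a \<odot> b"
  proof -
    have "x \<odot> y = - ((a - sc (of_real c) e) \<odot> (b \<odot> d))"
      using c c' by (simp add: x_def y_def sc_minus_left sc_minus_right mul_minus_right)
    then have "(e - x \<odot> y) \<odot> (e + sc (of_real c) b) =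
        (e + sc (of_real c) b) + (a - sc (of_real c) e) \<odot> (b \<odot> (d \<odot> (e + sc (of_real c) b)))"
      by (simp only: mul_diff_left mul_minus_left mul_assoc mul_e_left) simp
    also have "\<dots> = (e + sc (of_real c) b) + (a - sc (of_real c) e) \<odot> b"
      using d by (simp add: inverse_pair_def)
    also have "\<dots> = e + a \<odot> b" by (simp add: mul_diff_left)
    finally show ?thesis .
  qed
  ultimately show ?thesis by simp
qed

end

section \<open>The unitization and its spectra\<close>

definition usc :: "(complex \<Rightarrow> 'a \<Rightarrow> 'a) \<Rightarrow> complex \<Rightarrow> complex \<times> 'a \<Rightarrow> complex \<times> 'a" where
  "usc cs c p = (c * fst p, cs c (snd p))"

text \<open>Four products occur when the norm of \<open>umult cs p q\<close> is expanded, each at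
  most \<open>norm p * norm q\<close>; hence the constant 4.\<close>

lemma unital_complex_banach_unitization:
  fixes cs :: "complex \<Rightarrow> 'a::{real_normed_algebra,banach} \<Rightarrow> 'a"
  assumes "complex_banach_algebra cs"
  shows "unital_complex_banach (umult cs) (usc cs) (1, 0) 4"
proof -
  have add_r: "cs c (x + y) = cs c x + cs c y" and add_l: "cs (c + d) x = cs c x + cs d x"
    and assoc: "cs c (cs d x) = cs (c * d) x" and real: "cs (complex_of_real r) x = r *\<^sub>R x"
    and mul_l: "cs c x * y = cs c (x * y)" and mul_r: "x * cs c y = cs c (x * y)"
    and nrm: "norm (cs c x) = norm c * norm x" for c d x y r
    using assms unfolding complex_banach_algebra_def by metis+
  have one: "cs 1 x = x" and zero: "cs 0 x = 0" and zero_r: "cs c 0 = 0" for x c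
    using real[of 1] real[of 0] add_r[of c 0 0] by auto
  have bound: "norm (umult cs p q) \<le> 4 * norm p * norm q" for p q
  proof -
    define s t where "s = norm p" and "t = norm q"
    have st: "cmod (fst p) \<le> s" "norm (snd p) \<le> s" "cmod (fst q) \<le> t" "norm (snd q) \<le> t"
      unfolding s_def t_def by (metis norm_fst_le prod.collapse norm_snd_le)+
    then have st': "s \<ge> 0" "t \<ge> 0" by (auto simp: s_def t_def)
    have "norm (umult cs p q) \<le> cmod (fst p * fst q)
        + norm (cs (fst p) (snd q) + cs (fst q) (snd p) + snd p * snd q)"
      unfolding umult_def by (rule norm_Pair_le)
    also have "\<dots> \<le> cmod (fst p) * cmod (fst q) + (cmod (fst p) * norm (snd q)
        + cmod (fst q) * norm (snd p) + norm (snd p) * norm (snd q))"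
      by (intro add_mono order.trans[OF norm_triangle_ineq] norm_mult_ineq)
        (auto simp: norm_mult nrm)
    also have "\<dots> \<le> s * t + (s * t + t * s + s * t)"
      using st st' by (intro add_mono mult_mono) auto
    finally show ?thesis by (simp add: s_def t_def mult_ac)
  qed
  show ?thesis
  proof
    show "norm (umult cs p q) \<le> 4 * norm p * norm q" for p q
      by (rule bound)
    show "norm (usc cs c p) = cmod c * norm p" for c p
      by (simp add: usc_def norm_prod_def nrm norm_mult power_mult_distrib real_sqrt_mult
          flip: distrib_left)
  qed (auto simp: umult_def usc_def add_r add_l assoc mul_l mul_r one zero zero_r real
      prod_eq_iff algebra_simps scaleR_conv_of_real)
qed

text \<open>Allows the unitization to be used even if the algebra has a unit \<open>u\<close>. Then
  \<open>e - u\<close> splits off a copy of the scalars on which \<open>z e - a\<close> acts as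
  \<open>z\<close>, whence \<open>z \<noteq> 0\<close>.\<close>

lemma not_in_spec_iff:
  fixes cs :: "complex \<Rightarrow> 'a::{real_normed_algebra,banach} \<Rightarrow> 'a"
  assumes cs: "complex_banach_algebra cs" and z: "z \<noteq> 0"
  shows "z \<notin> spec cs a \<longleftrightarrow> (\<exists>q. umult cs (z, - a) q = (1, 0) \<and> umult cs q (z, - a) = (1, 0))"
proof (cases "unital_alg TYPE('a)")
  case False
  then show ?thesis by (simp add: spec_def)
next
  case True
  define u where "u = (SOME u::'a. is_unit_elem u)"
  have "is_unit_elem u"
    using True unfolding unital_alg_def u_def by (rule someI_ex)
  then have u: "u * x = x" "x * u = x" for x by (auto simp: is_unit_elem_def)
  have add_r: "cs c (x + y) = cs c x + cs c y"
    and assoc: "cs c (cs d x) = cs (c * d) x" and one: "cs 1 x = x"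
    and mul_l: "cs c x * y = cs c (x * y)" and mul_r: "x * cs c y = cs c (x * y)" for c d x y
    using cs unfolding complex_banach_algebra_def by (metis of_real_1 scaleR_one)+
  have minus: "cs c (- x) = - cs c x" for c x
    using add_r[of c x "- x"] add_r[of c 0 0] by (simp add: eq_neg_iff_add_eq_0 add.commute)
  have diff: "cs c (x - y) = cs c x - cs c y" for c x y
    using add_r[of c x "- y"] by (simp add: minus)
  have spec: "z \<notin> spec cs a \<longleftrightarrow> (\<exists>b. (cs z u - a) * b = u \<and> b * (cs z u - a) = u)"
    using True by (simp add: spec_def Let_def flip: u_def)
  show ?thesis unfolding spec
  proof
    assume "\<exists>b. (cs z u - a) * b = u \<and> b * (cs z u - a) = u"
    then obtain b where "cs z b - a * b = u" "cs z b - b * a = u"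
      by (auto simp: left_diff_distrib right_diff_distrib mul_l mul_r u)
    \<comment> \<open>The inverse is \<open>1/z\<close> on the summand spanned by
      \<open>e - u\<close> and \<open>b\<close> on the algebra.\<close>
    then have "umult cs (z, - a) (1 / z, b - cs (1 / z) u) = (1, 0)"
      "umult cs (1 / z, b - cs (1 / z) u) (z, - a) = (1, 0)"
      using z by (auto simp: umult_def diff minus assoc one mul_l mul_r u algebra_simps)
    then show "\<exists>q. umult cs (z, - a) q = (1, 0) \<and> umult cs q (z, - a) = (1, 0)" by blast
  next
    assume "\<exists>q. umult cs (z, - a) q = (1, 0) \<and> umult cs q (z, - a) = (1, 0)"
    then obtain w y where q: "umult cs (z, - a) (w, y) = (1, 0)" "umult cs (w, y) (z, - a) = (1, 0)"
      by auto
    then have w: "w = 1 / z" using z by (simp add: umult_def field_simps)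
    have "(cs z u - a) * (y + cs (1 / z) u) = u" "(y + cs (1 / z) u) * (cs z u - a) = u"
      using q z by (auto simp: w umult_def add_r diff minus assoc one mul_l mul_r u algebra_simps)
    then show "\<exists>b. (cs z u - a) * b = u \<and> b * (cs z u - a) = u" by blast
  qed
qed

section \<open>Positive elements of a Hermitian algebra\<close>

theorem theorem17p5:
  fixes cs :: "complex \<Rightarrow> 'a::{real_normed_algebra,banach} \<Rightarrow> 'a"
    and star :: "'a \<Rightarrow> 'a"
    and a b :: 'a
  assumes "banach_star_algebra cs star"
    and "hermitian_alg cs star"
    and "positive_elem cs star a"
    and "positive_elem cs star b"
  shows "positive_elem cs star (a * b) \<longleftrightarrow> a * b = b * a"
proof -
  have cs: "complex_banach_algebra cs" and star_mult: "star (x * y) = star y * star x" for x y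
    using assms(1) by (auto simp: banach_star_algebra_def involution_def)
  have herm: "star a = a" "star b = b" using assms(3,4) by (auto simp: positive_elem_def)
  interpret U: unital_complex_banach "umult cs" "usc cs" "(1, 0)" 4
    by (rule unital_complex_banach_unitization[OF cs])
  have sc0: "cs c 0 = 0" "cs 0 x = 0" and scm: "cs c (- x) = - cs c x" for c x
    using U.sc_0_right[of c] U.sc_0_left[of "(0, x)"] U.sc_minus_right[of c "(0, x)"] by (auto simp: usc_def zero_prod_def)
  have scsc: "cs c (cs d x) = cs (c * d) x" and sc1: "cs 1 x = x"
    and mul: "x * cs c y = cs c (x * y)" "cs c x * y = cs c (x * y)" for c d x y
    using cs unfolding complex_banach_algebra_def by (metis of_real_1 scaleR_one)+
  \<comment> \<open>Passes from \<open>z e - x\<close> to \<open>e - x / z\<close>, the reciprocal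
    form used in \<open>nonneg_spectrum\<close>.\<close>
  have spec: "z \<notin> spec cs x \<longleftrightarrow> U.invertible ((1, 0) - usc cs (1 / z) (0, x))"
    if z: "z \<noteq> 0" for z x
  proof -
    have "(z, - x) = usc cs z ((1, 0) - usc cs (1 / z) (0, x))"
      using z by (simp add: usc_def scm scsc sc1)
    moreover have "(1, 0) - usc cs (1 / z) (0, x) = usc cs (1 / z) (z, - x)"
      using z by (simp add: usc_def scm)
    ultimately have "U.invertible (z, - x) \<longleftrightarrow> U.invertible ((1, 0) - usc cs (1 / z) (0, x))"
      using z by (metis U.invertible_sc divide_eq_0_iff zero_neq_one)
    then show ?thesis
      using not_in_spec_iff[OF cs z] by (simp add: U.invertible_def U.inverse_pair_def)
  qed
  have pos: "U.nonneg_spectrum (0, cs (of_real r) x)"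
    if x: "positive_elem cs star x" and r: "r > 0" for x r
    unfolding U.nonneg_spectrum_def
  proof (intro allI impI)
    fix w assume w: "w \<notin> complex_of_real ` {0<..}"
    show "U.invertible ((1, 0) - usc cs w (0, cs (of_real r) x))"
    \<comment> \<open>\<open>w = 0\<close> is the reciprocal of no spectral parameter; the element
      is then \<open>e\<close> itself.\<close>
    proof (cases "w = 0")
      case True
      then show ?thesis
        using U.invertible_one_minus[of 0] by simp
    next
      case False
      have "1 / (w * of_real r) \<notin> complex_of_real ` {0..}"
      proof
        assume "1 / (w * of_real r) \<in> complex_of_real ` {0..}"
        then obtain t where t: "t \<ge> 0" "1 / (w * of_real r) = of_real t" by auto
        then have "t > 0" using False r by (cases "t = 0") auto
        moreover have "w = of_real (1 / (t * r))"
          using t \<open>t > 0\<close> r False by (simp add: field_simps)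
        moreover have "1 / (t * r) > 0" using \<open>t > 0\<close> r by simp
        ultimately show False using w by blast
      qed
      then have "1 / (w * of_real r) \<notin> spec cs x"
        using x by (auto simp: positive_elem_def)
      then show ?thesis
        using spec[of "1 / (w * of_real r)" x] False r by (simp add: usc_def scsc)
    qed
  qed
  show ?thesis
  proof
    assume "positive_elem cs star (a * b)"
    then have "star (a * b) = a * b" by (simp add: positive_elem_def)
    then show "a * b = b * a" by (simp add: star_mult herm)
  next
    assume comm: "a * b = b * a"
    have ab: "star (a * b) = a * b" by (simp add: star_mult herm comm)
    have "z \<in> complex_of_real ` {0..}" if z: "z \<in> spec cs (a * b)" for z
    proof (rule ccontr)
      assume nonneg: "z \<notin> complex_of_real ` {0..}"
      \<comment> \<open>The Hermitian hypothesis leaves only negative real \<open>z\<close> to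
        exclude.\<close>
      obtain t where t: "z = complex_of_real t"
        using assms(2) ab z unfolding hermitian_alg_def by (blast elim: Reals_cases)
      then have t0: "t < 0" using nonneg by (metis atLeast_iff image_eqI not_less)
      \<comment> \<open>Chosen so that \<open>e - a b / z\<close> becomes
        \<open>e + (r a) b\<close>, with \<open>r a\<close> again of nonnegative spectrum.\<close>
      define r where "r = - 1 / t"
      have r: "r > 0" using t0 by (simp add: r_def)
      have "U.invertible ((1, 0) + umult cs (0, cs (of_real r) a) (0, cs (of_real 1) b))"
        by (rule U.invertible_one_plus_mul)
          (use pos[OF assms(3) r] pos[OF assms(4), of 1] comm in \<open>auto simp: umult_def sc0 sc1 mul\<close>)
      moreover have "(1, 0) + umult cs (0, cs (of_real r) a) (0, cs (of_real 1) b)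
          = (1, 0) - usc cs (1 / z) (0, a * b)"
      proof -
        have "1 / z = - of_real r" using t t0 by (simp add: r_def)
        then show ?thesis
          using U.sc_minus_left[of "of_real r" "(0, a * b)"]
          by (simp add: umult_def usc_def sc0 sc1 mul)
      qed
      ultimately show False using spec[of z "a * b"] z t t0 by simp
    qed
    then show "positive_elem cs star (a * b)" by (auto simp: positive_elem_def ab)
  qed
qed

end
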